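(* Let $n,p\ge 1$ be integers satisfying $$n \ge p + \frac12 + \sqrt{2p+\frac14}.$$ If $X$ is a random $n\times p$ matrix sampled from a distribution that is absolutely continuous with respect to the Lebesgue measure on $\mathbb{R}^{n\times p}$, then $Q\odot Q$ is invertible almost surely, where $Q = I_n - X(X^\top X)^{-1}X^\top$.
   Context: $I_n$ is the $n\times n$ identity matrix. For a matrix $M$, $M\odot M$ denotes the Hadamard (entrywise) product of $M$ with itself, i.e. $(M\odot M)_{ij}=M_{ij}^2$. The matrix $Q$ is defined whenever $X^\top X$ is invertible. *)

theory Defs
  imports "HOL-Probability.Probability"
begin

definition hadamard :: "'a::times ^ 'm ^ 'n \<Rightarrow> 'a ^ 'm ^ 'n \<Rightarrow> 'a ^ 'm ^ 'n"  (infixl \<open>\<odot>\<close> 70)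
  where "A \<odot> B = (\<chi> i j. A $ i $ j * B $ i $ j)"

(* An n x p matrix has type real ^ 'p ^ 'n with CARD('n) = n, CARD('p) = p; mat 1 is the n x n
   identity. The value is meaningful only when transpose X ** X is invertible: matrix_inv is
   unspecified otherwise. *)
definition resid_proj :: "real ^ 'p ^ 'n \<Rightarrow> real ^ 'n ^ 'n"
  where "resid_proj X = mat 1 - X ** matrix_inv (transpose X ** X) ** transpose X"

end

theory Submission
  imports Defs
begin

text \<open>
  Write \<open>n = CARD('n)\<close>, \<open>p = CARD('p)\<close> and \<open>k = n - p\<close>. After clearing the denominator
  \<open>det (X\<^sup>T X)\<close>, the two invertibility conditions together say that one real polynomial in the
  entries of \<open>X\<close> does not vanish (\<open>invertible_hadamard_polynomial\<close>). The zero set of a polynomial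
  that is not identically zero is Lebesgue-null (\<open>AE_real_polynomial_function_nonzero\<close>), and absolute
  continuity carries this over to the law of \<open>X\<close>. It therefore suffices to find a single matrix for
  which both conditions hold (\<open>exists_invertible_hadamard\<close>).

  For the witness, let \<open>Q\<close> be the orthogonal projection onto \<open>U = ker X\<^sup>T\<close>. If \<open>(Q \<odot> Q) x = 0\<close>,
  then \<open>Q diag(x) Q\<close> vanishes, that is, \<open>x\<close> is orthogonal to every entrywise product of two
  vectors of \<open>U\<close> (\<open>projection_hadamard_kernel\<close>). So \<open>Q \<odot> Q\<close> is invertible as soon as these
  products span the whole space. As \<open>U\<close> has dimension \<open>k\<close> they span at most \<open>k (k + 1) / 2\<close>
  dimensions, and the hypothesis on \<open>n\<close> and \<open>p\<close> is exactly \<open>n \<le> k (k + 1) / 2\<close>, or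
  equivalently \<open>p \<le> k choose 2\<close> (\<open>card_le_choose_codim\<close>). In this form it allows the following
  choice of \<open>U\<close>: take \<open>k\<close> free coordinates, and let each of the remaining \<open>p\<close> coordinates be
  \<open>u\<^sub>s + u\<^sub>t\<close>, with a different pair \<open>{s, t}\<close> of free coordinates each time. The quadratic
  form \<open>\<Sum>\<^sub>i x\<^sub>i u\<^sub>i\<^sup>2\<close> on \<open>U\<close> then has each of those \<open>x\<^sub>i\<close> as half of the coefficient of
  its own mixed monomial \<open>u\<^sub>s u\<^sub>t\<close>, so all coefficients \<open>x\<^sub>i\<close> can be read off from the form.
\<close>

section \<open>Zero sets of polynomial functions\<close>

lemma real_polynomial_function_finite_zeros:
  fixes f :: "real \<Rightarrow> real"
  assumes "real_polynomial_function f" and "f t\<^sub>0 \<noteq> 0"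
  shows "finite {t. f t = 0}"
proof -
  obtain a n where f: "f = (\<lambda>t. \<Sum>i\<le>n. a i * t ^ i)"
    using real_polynomial_function_imp_sum[OF assms(1)] by blast
  have "\<exists>i\<le>n. a i \<noteq> 0"
  proof (rule ccontr)
    assume "\<not> (\<exists>i\<le>n. a i \<noteq> 0)"
    then have "f t\<^sub>0 = 0"
      by (simp add: f)
    with assms(2) show False ..
  qed
  then show ?thesis
    unfolding f by (simp only: polyfun_finite_roots)
qed

text \<open>
  Every line through a point \<open>x\<^sub>0\<close> with \<open>f x\<^sub>0 \<noteq> 0\<close> meets the zero set in finitely many points.
  By Fubini, for almost every scale \<open>t\<close> the set of all \<open>x\<close> with \<open>f (x\<^sub>0 + t x) = 0\<close> is null; for
  one such \<open>t \<noteq> 0\<close> the zero set is an affine image of it.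
\<close>

lemma AE_real_polynomial_function_nonzero:
  fixes f :: "'a::euclidean_space \<Rightarrow> real"
  assumes f: "real_polynomial_function f" and x\<^sub>0: "f x\<^sub>0 \<noteq> 0"
  shows "AE x in lborel. f x \<noteq> 0"
proof -
  have cont: "continuous_on UNIV f"
    using f by (simp add: continuous_on_eq_continuous_within continuous_real_polymonial_function
        continuous_at_imp_continuous_within)
  then have meas: "f \<in> borel_measurable borel"
    by (rule borel_measurable_continuous_onI)
  have "AE t in lborel. f (x\<^sub>0 + t *\<^sub>R x) \<noteq> 0" for x
  proof -
    have "polynomial_function (\<lambda>t::real. x\<^sub>0 + t *\<^sub>R x)"
      by (intro polynomial_function_add polynomial_function_const polynomial_function_mult
          polynomial_function_id)
    then have "real_polynomial_function (\<lambda>t. f (x\<^sub>0 + t *\<^sub>R x))"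
      using real_polynomial_function_compose[OF _ f] by (simp add: o_def)
    then have "finite {t. f (x\<^sub>0 + t *\<^sub>R x) = 0}"
      by (rule real_polynomial_function_finite_zeros[where t\<^sub>0 = 0]) (simp add: x\<^sub>0)
    then have "{t. f (x\<^sub>0 + t *\<^sub>R x) = 0} \<in> null_sets lborel"
      by (rule finite_imp_null_set_lborel)
    then show ?thesis
      by (rule AE_I'[where N = "{t. f (x\<^sub>0 + t *\<^sub>R x) = 0}"]) auto
  qed
  then have "AE x in lborel. AE t in lborel. f (x\<^sub>0 + t *\<^sub>R x) \<noteq> 0"
    by simp
  moreover have "{z \<in> space (lborel \<Otimes>\<^sub>M lborel). f (x\<^sub>0 + snd z *\<^sub>R fst z) \<noteq> 0}
      \<in> sets (lborel \<Otimes>\<^sub>M (lborel :: real measure))"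
    using meas by measurable
  ultimately have "AE t::real in lborel. AE x in lborel. f (x\<^sub>0 + t *\<^sub>R x) \<noteq> 0"
    using lborel_pair.AE_commute[where P = "\<lambda>x t. f (x\<^sub>0 + t *\<^sub>R x) \<noteq> 0"] by simp
  moreover have "AE t::real in lborel. t \<noteq> 0"
    by (rule AE_lborel_singleton)
  ultimately have "AE t::real in lborel. t \<noteq> 0 \<and> (AE x in lborel. f (x\<^sub>0 + t *\<^sub>R x) \<noteq> 0)"
    by eventually_elim simp
  then have "\<exists>t::real. t \<noteq> 0 \<and> (AE x in lborel. f (x\<^sub>0 + t *\<^sub>R x) \<noteq> 0)"
    by (rule eventually_happens'[rotated]) (simp add: ae_filter_eq_bot_iff)
  then obtain t where t: "t \<noteq> 0" and ae: "AE x in lborel. f (x\<^sub>0 + t *\<^sub>R x) \<noteq> 0"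
    by blast
  have "AE x in density (distr lborel borel (\<lambda>x. x\<^sub>0 + t *\<^sub>R x)) (\<lambda>_. \<bar>t\<bar> ^ DIM('a)). f x \<noteq> 0"
    using ae meas t by (simp add: AE_density AE_distr_iff)
  then show ?thesis
    by (simp only: lborel_affine[OF t, symmetric])
qed

section \<open>Polynomial matrices and the adjugate\<close>

definition polynomial_matrix :: "('a::real_normed_vector \<Rightarrow> real ^ 'm ^ 'n) \<Rightarrow> bool"
  where "polynomial_matrix F \<longleftrightarrow> (\<forall>i j. real_polynomial_function (\<lambda>x. F x $ i $ j))"

lemma polynomial_matrix_const: "polynomial_matrix (\<lambda>x. A)"
  by (auto simp: polynomial_matrix_def)

lemma polynomial_matrix_id: "polynomial_matrix (\<lambda>X. X)"
  unfolding polynomial_matrix_def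
  by (intro allI real_polynomial_function.intros(1) bounded_linear_compose[OF bounded_linear_vec_nth]
      bounded_linear_vec_nth)

lemma polynomial_matrix_transpose:
  "polynomial_matrix F \<Longrightarrow> polynomial_matrix (\<lambda>x. transpose (F x))"
  by (simp add: polynomial_matrix_def transpose_def)

lemma polynomial_matrix_diff:
  "polynomial_matrix F \<Longrightarrow> polynomial_matrix G \<Longrightarrow> polynomial_matrix (\<lambda>x. F x - G x)"
  by (simp add: polynomial_matrix_def real_polynomial_function_diff)

lemma polynomial_matrix_scaleR:
  "real_polynomial_function f \<Longrightarrow> polynomial_matrix F \<Longrightarrow> polynomial_matrix (\<lambda>x. f x *\<^sub>R F x)"
  by (simp add: polynomial_matrix_def real_polynomial_function.intros(4))

lemma polynomial_matrix_mult:
  "polynomial_matrix F \<Longrightarrow> polynomial_matrix G \<Longrightarrow> polynomial_matrix (\<lambda>x. F x ** G x)"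
  by (auto simp: polynomial_matrix_def matrix_matrix_mult_def
      intro!: real_polynomial_function_sum real_polynomial_function.intros(4))

lemma polynomial_matrix_hadamard:
  "polynomial_matrix F \<Longrightarrow> polynomial_matrix G \<Longrightarrow> polynomial_matrix (\<lambda>x. F x \<odot> G x)"
  by (simp add: polynomial_matrix_def hadamard_def real_polynomial_function.intros(4))

lemma real_polynomial_function_det:
  "polynomial_matrix F \<Longrightarrow> real_polynomial_function (\<lambda>x. det (F x))"
  unfolding det_def polynomial_matrix_def
  by (intro real_polynomial_function_sum real_polynomial_function.intros(4) real_polynomial_function.intros(2)
      real_polynomial_function_prod finite_permutations finite) auto

text \<open>
  The entries are those of Cramer's rule for the equations \<open>A v = e\<^sub>j\<close>: the \<open>k\<close>-th column of
  \<open>A\<close> is replaced by \<open>e\<^sub>j\<close>. Unlike the inverse, this is polynomial in the entries of \<open>A\<close>.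
\<close>

definition adjugate :: "real ^ 'n ^ 'n \<Rightarrow> real ^ 'n ^ 'n"
  where "adjugate A = (\<chi> k j. det (\<chi> i l. if l = k then axis j 1 $ i else A $ i $ l))"

lemma polynomial_matrix_adjugate:
  assumes "polynomial_matrix F"
  shows "polynomial_matrix (\<lambda>x. adjugate (F x))"
proof -
  have "polynomial_matrix (\<lambda>x. \<chi> i l. if l = k then axis j 1 $ i else F x $ i $ l)" for j k
    unfolding polynomial_matrix_def
  proof (intro allI)
    show "real_polynomial_function (\<lambda>x. (\<chi> i l. if l = k then axis j 1 $ i else F x $ i $ l) $ i $ l)"
      for i l
      using assms by (cases "l = k") (auto simp: polynomial_matrix_def)
  qed
  then show ?thesis
    unfolding polynomial_matrix_def[of "\<lambda>x. adjugate (F x)"]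
    by (simp add: adjugate_def real_polynomial_function_det)
qed

lemma matrix_inv_right:
  assumes "invertible A"
  shows "A ** matrix_inv A = mat 1"
  using someI_ex[OF assms[unfolded invertible_def]] by (simp add: matrix_inv_def)

lemma adjugate_eq_matrix_inv:
  assumes "invertible A"
  shows "adjugate A = det A *\<^sub>R matrix_inv A"
proof -
  have d: "det A \<noteq> 0"
    using assms by (simp add: invertible_det_nz)
  have "A *v (matrix_inv A *v axis j 1) = axis j 1" for j
    using matrix_inv_right[OF assms] by (simp add: matrix_vector_mul_assoc)
  then have "matrix_inv A *v axis j 1
      = (\<chi> k. det (\<chi> i l. if l = k then axis j 1 $ i else A $ i $ l) / det A)" for j
    by (simp only: cramer[OF d])
  then have "matrix_inv A $ k $ j = adjugate A $ k $ j / det A" for k j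
    by (simp add: adjugate_def vec_eq_iff matrix_vector_mul_component inner_axis)
  then show ?thesis
    using d by (simp add: vec_eq_iff)
qed

section \<open>Residual projections\<close>

text \<open>
  With \<open>d = det (X\<^sup>T X)\<close>, the matrix \<open>N = d Q = d I - X adj(X\<^sup>T X) X\<^sup>T\<close> has polynomial entries
  everywhere, and \<open>N \<odot> N\<close> is \<open>d\<^sup>2\<close> times \<open>Q \<odot> Q\<close>. The polynomial \<open>d det (N \<odot> N)\<close> has
  the factor \<open>d\<close> so that it also detects the invertibility of \<open>X\<^sup>T X\<close>.
\<close>

lemma invertible_hadamard_polynomial:
  obtains f :: "real ^ 'p ^ 'n \<Rightarrow> real"
  where "real_polynomial_function f"
    and "\<And>X. f X \<noteq> 0 \<longleftrightarrow> invertible (transpose X ** X) \<and> invertible (resid_proj X \<odot> resid_proj X)"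
proof -
  define d :: "real ^ 'p ^ 'n \<Rightarrow> real" where "d X = det (transpose X ** X)" for X
  define N :: "real ^ 'p ^ 'n \<Rightarrow> real ^ 'n ^ 'n"
    where "N X = d X *\<^sub>R mat 1 - X ** adjugate (transpose X ** X) ** transpose X" for X
  have d: "real_polynomial_function d"
    unfolding d_def
    by (intro real_polynomial_function_det polynomial_matrix_mult polynomial_matrix_transpose
        polynomial_matrix_id)
  have N: "polynomial_matrix N"
    unfolding N_def
    by (intro polynomial_matrix_diff polynomial_matrix_scaleR polynomial_matrix_mult
        polynomial_matrix_adjugate polynomial_matrix_transpose polynomial_matrix_id
        polynomial_matrix_const d)
  show thesis
  proof
    show "real_polynomial_function (\<lambda>X. d X * det (N X \<odot> N X))"
      by (intro real_polynomial_function.intros(4) d real_polynomial_function_det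
          polynomial_matrix_hadamard N)
  next
    fix X
    have "det (N X \<odot> N X) \<noteq> 0 \<longleftrightarrow> invertible (resid_proj X \<odot> resid_proj X)" if "d X \<noteq> 0"
    proof -
      have "invertible (transpose X ** X)"
        using that by (simp add: d_def invertible_det_nz)
      then have "N X = d X *\<^sub>R resid_proj X"
        by (simp add: N_def resid_proj_def d_def adjugate_eq_matrix_inv scaleR_diff_right
            matrix_scalar_ac scalar_matrix_assoc)
      then have eq: "N X \<odot> N X = (d X)\<^sup>2 *\<^sub>R (resid_proj X \<odot> resid_proj X)"
        by (simp add: hadamard_def vec_eq_iff power2_eq_square)
      show ?thesis
        using that scalar_invertible[of "(d X)\<^sup>2" "resid_proj X \<odot> resid_proj X"]
          scalar_invertible[of "inverse ((d X)\<^sup>2)" "N X \<odot> N X"]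
        by (auto simp: eq simp flip: invertible_det_nz)
    qed
    then show "d X * det (N X \<odot> N X) \<noteq> 0 \<longleftrightarrow>
        invertible (transpose X ** X) \<and> invertible (resid_proj X \<odot> resid_proj X)"
      by (auto simp: d_def invertible_det_nz)
  qed
qed

lemma matrix_inv_symmetric:
  fixes A :: "real ^ 'n ^ 'n"
  assumes inv: "invertible A" and sym: "transpose A = A"
  shows "transpose (matrix_inv A) = matrix_inv A"
proof -
  have "transpose (matrix_inv A) ** transpose A = mat 1"
    by (simp only: matrix_inv_right[OF inv] transpose_mat flip: matrix_transpose_mul)
  then have "transpose (matrix_inv A) ** A ** matrix_inv A = matrix_inv A"
    by (simp only: sym matrix_mul_lid)
  then show ?thesis
    by (simp only: matrix_inv_right[OF inv] matrix_mul_rid flip: matrix_mul_assoc)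
qed

lemma resid_proj_symmetric:
  assumes "invertible (transpose X ** X)"
  shows "transpose (resid_proj X) = resid_proj X"
proof -
  have "transpose (matrix_inv (transpose X ** X)) = matrix_inv (transpose X ** X)"
    using assms by (rule matrix_inv_symmetric) (simp add: matrix_transpose_mul)
  then have "transpose (X ** matrix_inv (transpose X ** X) ** transpose X)
      = X ** matrix_inv (transpose X ** X) ** transpose X"
    by (simp add: matrix_transpose_mul matrix_mul_assoc)
  then show ?thesis
    by (simp add: resid_proj_def vec_eq_iff transpose_def mat_def)
qed

lemma resid_proj_vec:
  assumes "transpose X *v u = 0"
  shows "resid_proj X *v u = u"
  using assms
  by (simp add: resid_proj_def matrix_vector_mult_diff_rdistrib flip: matrix_vector_mul_assoc)

lemma resid_proj_idempotent:
  assumes "invertible (transpose X ** X)"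
  shows "resid_proj X ** resid_proj X = resid_proj X"
proof -
  let ?A = "transpose X ** X"
  have "transpose X *v (resid_proj X *v u) = 0" for u
  proof -
    have "transpose X *v (X *v (matrix_inv ?A *v (transpose X *v u)))
        = (?A ** matrix_inv ?A) *v (transpose X *v u)"
      by (simp only: matrix_vector_mul_assoc matrix_mul_assoc)
    also have "\<dots> = transpose X *v u"
      by (simp add: matrix_inv_right[OF assms])
    finally show ?thesis
      by (simp add: resid_proj_def matrix_vector_mult_diff_rdistrib matrix_vector_mult_diff_distrib
          flip: matrix_vector_mul_assoc)
  qed
  then show ?thesis
    by (simp add: matrix_eq resid_proj_vec flip: matrix_vector_mul_assoc)
qed

text \<open>
  Put \<open>D = diag(x)\<close> and \<open>R = Q D Q\<close>. The diagonal of \<open>R\<close> is \<open>(Q \<odot> Q) x = 0\<close>, and since \<open>Q\<close>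
  is a projection, the squared Frobenius norm \<open>tr (R R)\<close> equals \<open>tr (D R)\<close>, which only involves
  that diagonal. Hence \<open>R = 0\<close>, and the sum in question is \<open>u\<^sup>T R w\<close>.
\<close>

lemma projection_hadamard_kernel:
  fixes Q :: "real ^ 'n ^ 'n"
  assumes sym: "transpose Q = Q" and idem: "Q ** Q = Q" and x: "(Q \<odot> Q) *v x = 0"
    and u: "Q *v u = u" and w: "Q *v w = w"
  shows "(\<Sum>i\<in>UNIV. x $ i * u $ i * w $ i) = 0"
proof -
  define D :: "real ^ 'n ^ 'n" where "D = (\<chi> i j. if i = j then x $ i else 0)"
  define R where "R = Q ** D ** Q"
  have Qsym: "Q $ i $ j = Q $ j $ i" for i j
    using arg_cong[OF sym, of "\<lambda>A. A $ i $ j"] by (simp add: transpose_def)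
  have DQ: "(D ** B) $ i $ j = x $ i * B $ i $ j" for B :: "real ^ 'n ^ 'n" and i j
    by (simp add: D_def matrix_matrix_mult_def if_distrib[where f = "\<lambda>c. c * _"] cong: if_cong)
  have "transpose D = D"
    by (simp add: D_def transpose_def vec_eq_iff)
  then have Rsym: "transpose R = R"
    by (simp add: R_def matrix_transpose_mul sym matrix_mul_assoc)
  have diag: "R $ i $ i = 0" for i
  proof -
    have "R $ i $ i = (\<Sum>j\<in>UNIV. Q $ i $ j * (x $ j * Q $ j $ i))"
      unfolding R_def matrix_mul_assoc[symmetric]
      by (subst matrix_matrix_mult_def) (simp add: DQ)
    also have "\<dots> = ((Q \<odot> Q) *v x) $ i"
      by (simp add: matrix_vector_mult_def hadamard_def Qsym[of _ i] mult_ac)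
    finally show ?thesis
      by (simp add: x)
  qed
  have "R ** R = Q ** (D ** R)"
    by (simp add: R_def matrix_mul_assoc) (simp add: idem flip: matrix_mul_assoc)
  then have "trace (R ** R) = trace (D ** R ** Q)"
    by (simp only: trace_mul_sym[of Q])
  also have "D ** R ** Q = D ** R"
    by (simp add: R_def idem flip: matrix_mul_assoc)
  also have "trace (D ** R) = 0"
    by (simp add: trace_def DQ diag)
  finally have "(\<Sum>i\<in>UNIV. \<Sum>j\<in>UNIV. (R $ i $ j)\<^sup>2) = 0"
    using arg_cong[OF Rsym, of "\<lambda>A. A $ _ $ _"]
    by (simp add: trace_def matrix_matrix_mult_def transpose_def power2_eq_square)
  then have "R = 0"
    by (simp add: sum_nonneg_eq_0_iff sum_nonneg vec_eq_iff)
  then have "0 = inner u (R *v w)"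
    by simp
  also have "\<dots> = inner (u v* Q) (D *v (Q *v w))"
    by (simp only: R_def dot_lmul_matrix flip: matrix_vector_mul_assoc)
  also have "u v* Q = Q *v u"
    by (simp only: sym flip: transpose_matrix_vector)
  also have "inner (Q *v u) (D *v (Q *v w)) = inner u (D *v w)"
    by (simp only: u w)
  also have "\<dots> = (\<Sum>i\<in>UNIV. x $ i * u $ i * w $ i)"
    by (simp add: inner_vec_def D_def matrix_vector_mult_def mult_ac
        if_distrib[where f = "\<lambda>c. c * _"] if_distrib[where f = "\<lambda>c. _ * c"] cong: if_cong)
  finally show ?thesis ..
qed

section \<open>A matrix with invertible Hadamard square\<close>

text \<open>
  With \<open>k = n - p\<close> the hypothesis reads \<open>k - 1/2 \<ge> sqrt (2 p + 1/4)\<close>; squaring gives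
  \<open>k\<^sup>2 - k \<ge> 2 p\<close>.
\<close>

lemma card_le_choose_codim:
  fixes n p :: nat
  assumes "real n \<ge> real p + 1 / 2 + sqrt (2 * real p + 1 / 4)"
  shows "p \<le> n" and "p \<le> (n - p) choose 2"
proof -
  have "sqrt (2 * real p + 1 / 4) \<ge> 0"
    by simp
  with assms show "p \<le> n"
    by linarith
  define k where "k = n - p"
  have n: "real n = real p + real k"
    using \<open>p \<le> n\<close> by (simp add: k_def)
  with assms have "sqrt (2 * real p + 1 / 4) \<le> real k - 1 / 2"
    by linarith
  then have "2 * real p + 1 / 4 \<le> (real k - 1 / 2)\<^sup>2"
    by (rule sqrt_le_D)
  then have "2 * real p + real k \<le> real k * real k"
    by (simp add: power2_eq_square algebra_simps)
  then have "real (2 * p + k) \<le> real (k * k)"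
    by simp
  then have "2 * p + k \<le> k * k"
    by (simp only: of_nat_le_iff)
  then have "2 * p \<le> k * (k - 1)"
    by (simp add: diff_mult_distrib2)
  then show "p \<le> (n - p) choose 2"
    unfolding k_def[symmetric] choose_two by linarith
qed

text \<open>
  The free coordinates form \<open>K\<close>; the coordinate \<open>f j\<close> is tied to the pair \<open>g j\<close> by the \<open>j\<close>-th
  column of \<open>X\<close>, which expresses the equation \<open>u\<^bsub>f j\<^esub> = u\<^sub>s + u\<^sub>t\<close> for \<open>g j = {s, t}\<close>. For
  \<open>s \<in> K\<close> the vectors \<open>U s\<close>, extending the unit vectors at \<open>s\<close> by these equations, form a basis of
  the kernel of \<open>X\<^sup>T\<close>. Testing against \<open>U s\<close> and \<open>U t\<close> isolates \<open>x $ f j\<close>; once these are known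
  to vanish, testing against \<open>U s\<close> twice isolates \<open>x $ s\<close>.
\<close>

lemma exists_invertible_hadamard:
  assumes "CARD('p) \<le> CARD('n)" and "CARD('p) \<le> (CARD('n) - CARD('p)) choose 2"
  shows "\<exists>X :: real ^ 'p ^ 'n. invertible (transpose X ** X) \<and>
    invertible (resid_proj X \<odot> resid_proj X)"
proof -
  obtain f :: "'p \<Rightarrow> 'n" where f: "inj f"
    using assms(1) card_le_inj[of "UNIV :: 'p set" "UNIV :: 'n set"] by auto
  define K where "K = - range f"
  have "card K = CARD('n) - CARD('p)"
    using f by (simp add: K_def Compl_eq_Diff_UNIV card_Diff_subset card_image)
  then have "card {S. S \<subseteq> K \<and> card S = 2} = (CARD('n) - CARD('p)) choose 2"
    by (simp add: n_subsets)
  then obtain g where g: "range g \<subseteq> {S. S \<subseteq> K \<and> card S = 2}" "inj (g :: 'p \<Rightarrow> 'n set)"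
    using assms(2) card_le_inj[of "UNIV :: 'p set" "{S. S \<subseteq> K \<and> card S = 2}"] by auto
  have gK: "g j \<subseteq> K" and gcard: "card (g j) = 2" for j
    using g(1) by auto
  have fK: "f j \<notin> K" for j
    by (simp add: K_def)
  define X :: "real ^ 'p ^ 'n"
    where "X = (\<chi> i j. if i = f j then 1 else if i \<in> g j then - 1 else 0)"
  define U :: "'n \<Rightarrow> real ^ 'n"
    where "U s = (\<chi> i. if i = s \<or> (\<exists>j. i = f j \<and> s \<in> g j) then 1 else 0)" for s
  have U_f: "U s $ f j = (if s \<in> g j then 1 else 0)" if "s \<in> K" for s j
    using that fK f by (auto simp: U_def inj_eq)
  have U_K: "U s $ i = (if i = s then 1 else 0)" if "i \<in> K" for s i
    using that fK by (auto simp: U_def)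
  have split: "(\<Sum>i\<in>UNIV. h i) = (\<Sum>i\<in>K. h i) + (\<Sum>j\<in>UNIV. h (f j))" for h :: "'n \<Rightarrow> real"
  proof -
    have "(\<Sum>i\<in>UNIV. h i) = (\<Sum>i\<in>K. h i) + (\<Sum>i\<in>range f. h i)"
      using sum.subset_diff[of "range f" UNIV h] by (simp add: K_def Compl_eq_Diff_UNIV)
    then show ?thesis
      using f by (simp add: sum.reindex)
  qed
  have X_f: "X $ f i $ j = (if i = j then 1 else 0)" for i j
    using f gK[of j] fK[of i] by (auto simp: X_def inj_eq)
  have X_K: "X $ i $ j = (if i \<in> g j then - 1 else 0)" if "i \<in> K" for i j
    using that fK by (auto simp: X_def)
  have inv: "invertible (transpose X ** X)"
  proof -
    have "y = 0" if y: "(transpose X ** X) *v y = 0" for y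
    proof -
      have "inner (X *v y) (X *v y) = inner ((transpose X ** X) *v y) y"
        by (metis dot_lmul_matrix matrix_vector_mul_assoc transpose_matrix_vector)
      then have "X *v y = 0"
        using y by simp
      then have "(X *v y) $ f j = 0" for j
        by simp
      then show ?thesis
        by (simp add: vec_eq_iff matrix_vector_mult_def X_f if_distrib[where f = "\<lambda>c. c * _"]
            cong: if_cong)
    qed
    then show ?thesis
      unfolding invertible_left_inverse matrix_left_invertible_ker by blast
  qed
  have XU: "transpose X *v U s = 0" if "s \<in> K" for s
  proof -
    have "(\<Sum>i\<in>UNIV. X $ i $ j * U s $ i) = 0" for j
    proof -
      have "(\<Sum>i\<in>K. X $ i $ j * U s $ i) = (\<Sum>i\<in>K. if i = s then X $ i $ j else 0)"
        by (intro sum.cong) (auto simp: U_K)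
      also have "\<dots> = - (if s \<in> g j then 1 else 0)"
        using that by (simp add: X_K)
      finally show ?thesis
        unfolding split using that
        by (simp add: X_f U_f if_distrib[where f = "\<lambda>c. c * _"] cong: if_cong)
    qed
    then show ?thesis
      by (simp add: vec_eq_iff matrix_vector_mult_def transpose_def)
  qed
  have "x = 0" if x: "(resid_proj X \<odot> resid_proj X) *v x = 0" for x
  proof -
    have orth: "(\<Sum>i\<in>K. x $ i * U s $ i * U t $ i) + (\<Sum>j\<in>UNIV. x $ f j * U s $ f j * U t $ f j) = 0"
      if "s \<in> K" "t \<in> K" for s t
      using projection_hadamard_kernel[OF resid_proj_symmetric[OF inv] resid_proj_idempotent[OF inv] x
          resid_proj_vec[OF XU[OF that(1)]] resid_proj_vec[OF XU[OF that(2)]]]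
      by (simp only: split)
    have xf: "x $ f j = 0" for j
    proof -
      obtain s t where st: "g j = {s, t}" "s \<noteq> t"
        using gcard[of j] by (auto simp: card_2_iff)
      then have K: "s \<in> K" "t \<in> K"
        using gK[of j] by auto
      have "s \<in> g i \<and> t \<in> g i \<longleftrightarrow> i = j" for i
      proof
        \<comment> \<open>Two 2-element sets that share both elements coincide, and \<open>g\<close> is injective.\<close>
        assume "s \<in> g i \<and> t \<in> g i"
        then have "g j = g i"
          using st gcard[of i] by (intro card_seteq) (auto intro: card_ge_0_finite)
        then show "i = j"
          using g(2) by (simp add: inj_eq)
      qed (simp add: st)
      then have "(\<Sum>i\<in>UNIV. x $ f i * U s $ f i * U t $ f i) = (\<Sum>i\<in>UNIV. if i = j then x $ f i else 0)"
        by (intro sum.cong) (auto simp: U_f K)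
      moreover have "(\<Sum>i\<in>K. x $ i * U s $ i * U t $ i) = 0"
        using st by (intro sum.neutral) (auto simp: U_K)
      ultimately show ?thesis
        using orth[OF K] by simp
    qed
    have xK: "x $ s = 0" if "s \<in> K" for s
    proof -
      have "(\<Sum>i\<in>K. x $ i * U s $ i * U s $ i) = (\<Sum>i\<in>K. if i = s then x $ i else 0)"
        by (intro sum.cong) (auto simp: U_K)
      then show ?thesis
        using orth[OF that that] that by (simp add: xf)
    qed
    have "x $ i = 0" for i
      using xf xK by (cases "i \<in> K") (auto simp: K_def)
    then show ?thesis
      by (simp add: vec_eq_iff)
  qed
  then have "invertible (resid_proj X \<odot> resid_proj X)"
    unfolding invertible_left_inverse matrix_left_invertible_ker by blast
  with inv show ?thesis
    by blast
qed

section \<open>Almost sure invertibility\<close>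

theorem mainTheorem3:
  fixes M :: "'a measure" and X :: "'a \<Rightarrow> real ^ 'p ^ 'n"
  assumes "real CARD('n) \<ge> real CARD('p) + 1 / 2 + sqrt (2 * real CARD('p) + 1 / 4)"
    and "prob_space M"
    and "X \<in> borel_measurable M"
    and "absolutely_continuous lborel (distr M lborel X)"
  shows "AE \<omega> in M. invertible (transpose (X \<omega>) ** X \<omega>) \<and>
           invertible (resid_proj (X \<omega>) \<odot> resid_proj (X \<omega>))"
proof -
  obtain f :: "real ^ 'p ^ 'n \<Rightarrow> real" where f: "real_polynomial_function f"
    and f_iff: "\<And>X. f X \<noteq> 0 \<longleftrightarrow>
      invertible (transpose X ** X) \<and> invertible (resid_proj X \<odot> resid_proj X)"
    using invertible_hadamard_polynomial by blast
  obtain X\<^sub>0 where "f X\<^sub>0 \<noteq> 0"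
    using exists_invertible_hadamard[OF card_le_choose_codim[OF assms(1)]] f_iff by blast
  with f have "AE Z in lborel. f Z \<noteq> 0"
    by (rule AE_real_polynomial_function_nonzero)
  then have "AE Z in distr M lborel X. f Z \<noteq> 0"
    by (rule absolutely_continuous_AE[OF _ assms(4), rotated]) simp
  then have "AE \<omega> in M. f (X \<omega>) \<noteq> 0"
    by (rule AE_distrD[rotated]) (use assms(3) in simp)
  then show ?thesis
    by (simp only: f_iff)
qed

end
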